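(* Let $(M,g)$ be a compact Riemannian manifold without boundary and let $\{e_j\}_{j\in\mathbb N}$ be an orthonormal basis of $L^2(M)$ with $\Delta_g e_j=-\lambda_j^2e_j$, $\lambda_j\ge0$. Let $S$ be a finite subset of the set of eigenvalues of $\sqrt{-\Delta_g}$ and let $X_S=\{j:\lambda_j\in S\}$. Suppose that $f\in L^2(M)$ is not identically $0$ and is $L^2$-concentrated in $E\subset M$ at level $L$ with respect to the Riemannian volume density. Suppose also that $\widehat f$ is $L^2$-concentrated on $X_S$ at level $L'$ with respect to the counting measure. Then $$\left(\frac{1}{\#X_S}\sum_{j\in X_S}\frac{1}{|E|}\int_E|e_j(x)|^2\,dx\right)^{-1}\le(1-\epsilon-\epsilon')^{-2}\,|E|\,(\#X_S),$$ where $L=(1-\epsilon^2)^{-1/2}$ and $L'=(1-\epsilon'^2)^{-1/2}$ with $\epsilon,\epsilon'\in[0,1)$.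
   Context: $\Delta_g$ is the Laplace–Beltrami operator (negative semi-definite sign convention), $dx=dV_g$ is the Riemannian volume density, and $|E|$ is the Riemannian volume of $E$. The eigenvalues $\lambda_j$ of $\sqrt{-\Delta_g}$ are listed with multiplicity, $0=\lambda_1\le\lambda_2\le\cdots\to\infty$. The Fourier coefficients of $f$ are $\widehat f(j)=\int_M f\,\overline{e_j}\,dV_g$, viewed as a function on $\mathbb N$. Concentration: if $X$ is a measure space with measure $\mu$ and $E\subset X$, a function $f\in L^p(X,\mu)$ is $L^p$-concentrated on (in) $E$ at level $L\ge1$ if $\left(\int_X|f|^p\,d\mu\right)^{1/p}\le L\left(\int_E|f|^p\,d\mu\right)^{1/p}$.
   Formalization: The condition ε+ε'<1 is added: without it the printed inequality can fail (circle of length 1, S={0}, E an arc of length 0.01, f=1+4·1_E, ε=√0.8, ε'=0.99: left side 1, right side about 0.0128), and at ε+ε'=1 the right side is undefined. *)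

theory Defs
  imports "HOL-Analysis.Analysis"
begin

section \<open>Smooth functions on open subsets of Euclidean space\<close>

definition partial_deriv ::
    "'n \<Rightarrow> (real^'n \<Rightarrow> 'b::real_normed_vector) \<Rightarrow> real^'n \<Rightarrow> 'b" where
  "partial_deriv i f x = frechet_derivative f (at x) (axis i 1)"

text \<open>The derivatives are two-sided, so these notions are meant for open \<open>U\<close> only.
  The values of \<open>f\<close> outside \<open>U\<close> are then irrelevant.\<close>

primrec Ck_on ::
    "nat \<Rightarrow> (real^'n) set \<Rightarrow> (real^'n \<Rightarrow> 'b::real_normed_vector) \<Rightarrow> bool" where
  "Ck_on 0 U f \<longleftrightarrow> continuous_on U f"
| "Ck_on (Suc k) U f \<longleftrightarrow>
     (\<forall>x\<in>U. f differentiable (at x)) \<and> (\<forall>i. Ck_on k U (partial_deriv i f))"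

definition smooth_on :: "(real^'n) set \<Rightarrow> (real^'n \<Rightarrow> 'b::real_normed_vector) \<Rightarrow> bool" where
  "smooth_on U f \<longleftrightarrow> (\<forall>k. Ck_on k U f)"

section \<open>Compact Riemannian manifolds without boundary\<close>

text \<open>A chart \<open>(U, \<phi>)\<close> consists of its domain and its coordinate map. Only the values of \<open>\<phi>\<close> on \<open>U\<close>
  matter; \<open>inv_into U \<phi>\<close> is the local parametrisation.\<close>

type_synonym ('a, 'n) chart = "'a set \<times> ('a \<Rightarrow> real^'n)"

definition chart_image :: "('a, 'n::finite) chart \<Rightarrow> (real^'n) set" where
  "chart_image c = snd c ` fst c"

definition param :: "('a, 'n::finite) chart \<Rightarrow> real^'n \<Rightarrow> 'a" where
  "param c = inv_into (fst c) (snd c)"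

definition transition :: "('a, 'n::finite) chart \<Rightarrow> ('a, 'n) chart \<Rightarrow> real^'n \<Rightarrow> real^'n" where
  "transition c d = snd d \<circ> param c"

text \<open>\<open>metric M c x\<close> is the matrix of the components \<open>g\<^sub>i\<^sub>j\<close> of the metric in the chart \<open>c\<close> at the point
  with coordinates \<open>x\<close>. The dimension is \<open>CARD('n) \<ge> 1\<close>. Dimension 0 is excluded, but there \<open>L\<^sup>2\<close> is
  finite-dimensional and has no orthonormal basis indexed by the natural numbers.\<close>

record ('a, 'n::finite) riem =
  top_of :: "'a topology"
  atlas :: "('a, 'n) chart set"
  metric :: "('a, 'n) chart \<Rightarrow> real^'n \<Rightarrow> real^'n^'n"

definition smooth_manifold :: "('a, 'n::finite) riem \<Rightarrow> bool" where
  "smooth_manifold M \<longleftrightarrow>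
     Hausdorff_space (top_of M) \<and> second_countable (top_of M) \<and>
     (\<Union>c\<in>atlas M. fst c) = topspace (top_of M) \<and>
     (\<forall>c\<in>atlas M. openin (top_of M) (fst c) \<and> open (chart_image c) \<and>
        homeomorphic_map (subtopology (top_of M) (fst c)) (top_of_set (chart_image c)) (snd c)) \<and>
     (\<forall>c\<in>atlas M. \<forall>d\<in>atlas M. smooth_on (snd c ` (fst c \<inter> fst d)) (transition c d))"

text \<open>The last conjunct says that the local matrices are the components of one covariant 2-tensor:
  \<open>G\<^sub>c = J\<^sup>T (G\<^sub>d \<circ> \<tau>) J\<close>, with \<open>J\<close> the Jacobian matrix of the change of coordinates \<open>\<tau>\<close> from \<open>c\<close> to \<open>d\<close>.\<close>

definition riemannian_metric :: "('a, 'n::finite) riem \<Rightarrow> bool" where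
  "riemannian_metric M \<longleftrightarrow>
     (\<forall>c\<in>atlas M. \<forall>i j. smooth_on (chart_image c) (\<lambda>x. metric M c x $ i $ j)) \<and>
     (\<forall>c\<in>atlas M. \<forall>x\<in>chart_image c.
        transpose (metric M c x) = metric M c x \<and>
        (\<forall>v. v \<noteq> 0 \<longrightarrow> v \<bullet> (metric M c x *v v) > 0)) \<and>
     (\<forall>c\<in>atlas M. \<forall>d\<in>atlas M. \<forall>x\<in>snd c ` (fst c \<inter> fst d).
        let J = matrix (frechet_derivative (transition c d) (at x))
        in metric M c x = transpose J ** metric M d (transition c d x) ** J)"

definition compact_riemannian_manifold :: "('a, 'n::finite) riem \<Rightarrow> bool" where
  "compact_riemannian_manifold M \<longleftrightarrow>
     smooth_manifold M \<and> riemannian_metric M \<and> compact_space (top_of M)"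

text \<open>The Riemannian volume: the Borel measure with density \<open>\<surd>det g\<close> with respect to Lebesgue measure
  in every chart (this determines it, the topology being second countable), completed so that all
  Lebesgue measurable subsets of the manifold are covered.\<close>

definition riemannian_borel_volume :: "('a, 'n::finite) riem \<Rightarrow> 'a measure \<Rightarrow> bool" where
  "riemannian_borel_volume M \<nu> \<longleftrightarrow>
     space \<nu> = topspace (top_of M) \<and>
     sets \<nu> = sigma_sets (topspace (top_of M)) {U. openin (top_of M) U} \<and>
     (\<forall>c\<in>atlas M. \<forall>B\<in>sets \<nu>. B \<subseteq> fst c \<longrightarrow>
        emeasure \<nu> B = (\<integral>\<^sup>+ x\<in>snd c ` B. ennreal (sqrt (det (metric M c x))) \<partial>lborel))"

definition riemannian_volume :: "('a, 'n::finite) riem \<Rightarrow> 'a measure \<Rightarrow> bool" where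
  "riemannian_volume M \<mu> \<longleftrightarrow> (\<exists>\<nu>. riemannian_borel_volume M \<nu> \<and> \<mu> = completion \<nu>)"

section \<open>The Laplace--Beltrami operator\<close>

definition smooth_function :: "('a, 'n::finite) riem \<Rightarrow> ('a \<Rightarrow> complex) \<Rightarrow> bool" where
  "smooth_function M u \<longleftrightarrow> (\<forall>c\<in>atlas M. smooth_on (chart_image c) (u \<circ> param c))"

text \<open>The coordinate expression
  \<open>\<Delta>\<^sub>g u = (det g)\<^sup>-\<^sup>1\<^sup>/\<^sup>2 \<Sum>\<^sub>i \<partial>\<^sub>i (\<Sum>\<^sub>j (det g)\<^sup>1\<^sup>/\<^sup>2 g\<^sup>i\<^sup>j \<partial>\<^sub>j u)\<close>, which is negative semi-definite.\<close>

definition laplacian_coords ::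
    "(real^'n \<Rightarrow> real^'n^'n) \<Rightarrow> (real^'n \<Rightarrow> complex) \<Rightarrow> real^'n::finite \<Rightarrow> complex" where
  "laplacian_coords G u x =
     (\<Sum>i\<in>UNIV. partial_deriv i
        (\<lambda>y. \<Sum>j\<in>UNIV. (sqrt (det (G y)) * matrix_inv (G y) $ i $ j) *\<^sub>R partial_deriv j u y) x)
     /\<^sub>R sqrt (det (G x))"

text \<open>For smooth \<open>u\<close> the value does not depend on the chart chosen around \<open>p\<close>.\<close>

definition laplace_beltrami :: "('a, 'n::finite) riem \<Rightarrow> ('a \<Rightarrow> complex) \<Rightarrow> 'a \<Rightarrow> complex" where
  "laplace_beltrami M u p =
     (let c = (SOME c. c \<in> atlas M \<and> p \<in> fst c)
      in laplacian_coords (metric M c) (u \<circ> param c) (snd c p))"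

definition laplace_eigenfunction ::
    "('a, 'n::finite) riem \<Rightarrow> real \<Rightarrow> ('a \<Rightarrow> complex) \<Rightarrow> bool" where
  "laplace_eigenfunction M l u \<longleftrightarrow>
     smooth_function M u \<and> (\<exists>p\<in>topspace (top_of M). u p \<noteq> 0) \<and>
     (\<forall>p\<in>topspace (top_of M). laplace_beltrami M u p = - of_real (l\<^sup>2) * u p)"

definition sqrt_laplacian_eigenvalues :: "('a, 'n::finite) riem \<Rightarrow> real set" where
  "sqrt_laplacian_eigenvalues M = {l. l \<ge> 0 \<and> (\<exists>u. laplace_eigenfunction M l u)}"

section \<open>Orthonormal bases, Fourier coefficients and concentration\<close>

definition Lp_function :: "real \<Rightarrow> 'x measure \<Rightarrow> ('x \<Rightarrow> complex) \<Rightarrow> bool" where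
  "Lp_function p \<mu> f \<longleftrightarrow> f \<in> borel_measurable \<mu> \<and> integrable \<mu> (\<lambda>x. cmod (f x) powr p)"

definition L2_inner :: "'x measure \<Rightarrow> ('x \<Rightarrow> complex) \<Rightarrow> ('x \<Rightarrow> complex) \<Rightarrow> complex" where
  "L2_inner \<mu> f h = (\<integral>x. f x * cnj (h x) \<partial>\<mu>)"

text \<open>An orthonormal system whose finite linear combinations are dense in \<open>L\<^sup>2\<close>.\<close>

definition L2_orthonormal_basis :: "'x measure \<Rightarrow> (nat \<Rightarrow> 'x \<Rightarrow> complex) \<Rightarrow> bool" where
  "L2_orthonormal_basis \<mu> e \<longleftrightarrow>
     (\<forall>j. Lp_function 2 \<mu> (e j)) \<and>
     (\<forall>i j. L2_inner \<mu> (e i) (e j) = (if i = j then 1 else 0)) \<and>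
     (\<forall>f. Lp_function 2 \<mu> f \<longrightarrow>
        (\<forall>\<delta>>0. \<exists>N a. (\<integral>x. (cmod (f x - (\<Sum>j<N. a j * e j x)))\<^sup>2 \<partial>\<mu>) < \<delta>))"

definition fourier_coeff ::
    "'x measure \<Rightarrow> (nat \<Rightarrow> 'x \<Rightarrow> complex) \<Rightarrow> ('x \<Rightarrow> complex) \<Rightarrow> nat \<Rightarrow> complex" where
  "fourier_coeff \<mu> e f j = L2_inner \<mu> f (e j)"

definition Lp_concentrated ::
    "real \<Rightarrow> 'x measure \<Rightarrow> ('x \<Rightarrow> complex) \<Rightarrow> 'x set \<Rightarrow> real \<Rightarrow> bool" where
  "Lp_concentrated p \<mu> f E L \<longleftrightarrow>
     Lp_function p \<mu> f \<and> E \<in> sets \<mu> \<and> L \<ge> 1 \<and>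
     (\<integral>x. cmod (f x) powr p \<partial>\<mu>) powr (1 / p)
       \<le> L * (\<integral>x\<in>E. cmod (f x) powr p \<partial>\<mu>) powr (1 / p)"

end

theory Submission
  imports Defs
begin

text \<open>Write \<open>f\<^sub>E = 1\<^sub>E f\<close>. By Parseval and concentration, the restriction of the sequence
  \<open>(\<langle>f, e\<^sub>j\<rangle>)\<^sub>j\<close> to \<open>X\<close> has norm at least \<open>\<surd>(1 - \<epsilon>'\<^sup>2) \<parallel>f\<parallel> \<ge> (1 - \<epsilon>') \<parallel>f\<parallel>\<close>. By Bessel, replacing \<open>f\<close> by \<open>f\<^sub>E\<close>
  changes it by at most \<open>\<parallel>f - f\<^sub>E\<parallel> \<le> \<epsilon> \<parallel>f\<parallel>\<close>. Since \<open>\<langle>f\<^sub>E, e\<^sub>j\<rangle>\<close> only sees \<open>e\<^sub>j\<close> on \<open>E\<close>,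
  Cauchy--Schwarz gives \<open>(1 - \<epsilon> - \<epsilon>')\<^sup>2 \<le> \<Sum>\<^sub>j\<^sub>\<in>\<^sub>X \<integral>\<^sub>E |e\<^sub>j|\<^sup>2\<close>, which is the claim up to rearrangement.
  The geometry only enters through \<open>|E| < \<infinity>\<close> (by compactness) and through the finiteness of \<open>X\<close>.\<close>

section \<open>The inner product of square-integrable functions\<close>

lemma Lp_function_2_iff:
  "Lp_function 2 \<mu> f \<longleftrightarrow> f \<in> borel_measurable \<mu> \<and> integrable \<mu> (\<lambda>x. (cmod (f x))\<^sup>2)"
  by (simp add: Lp_function_def)

lemma Lp_function_2_scale:
  assumes "Lp_function 2 \<mu> f" shows "Lp_function 2 \<mu> (\<lambda>x. a * f x)"
  using assms by (auto simp: Lp_function_2_iff norm_mult power_mult_distrib)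

lemma Lp_function_2_add:
  assumes "Lp_function 2 \<mu> f" "Lp_function 2 \<mu> h"
  shows "Lp_function 2 \<mu> (\<lambda>x. f x + h x)"
proof -
  have "integrable \<mu> (\<lambda>x. (cmod (f x + h x))\<^sup>2)"
  proof (rule Bochner_Integration.integrable_bound)
    show "integrable \<mu> (\<lambda>x. 2 * (cmod (f x))\<^sup>2 + 2 * (cmod (h x))\<^sup>2)"
      using assms by (auto simp: Lp_function_2_iff)
    have "(cmod (f x + h x))\<^sup>2 \<le> 2 * (cmod (f x))\<^sup>2 + 2 * (cmod (h x))\<^sup>2" for x
    proof -
      have "(cmod (f x + h x))\<^sup>2 \<le> (cmod (f x) + cmod (h x))\<^sup>2"
        by (intro power_mono norm_triangle_ineq) auto
      also have "\<dots> \<le> 2 * (cmod (f x))\<^sup>2 + 2 * (cmod (h x))\<^sup>2"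
        using zero_le_power2[of "cmod (f x) - cmod (h x)"]
        by (simp add: power2_sum power2_diff)
      finally show ?thesis .
    qed
    then show "AE x in \<mu>. norm ((cmod (f x + h x))\<^sup>2)
        \<le> norm (2 * (cmod (f x))\<^sup>2 + 2 * (cmod (h x))\<^sup>2)"
      by simp
  qed (use assms in \<open>auto simp: Lp_function_2_iff\<close>)
  then show ?thesis using assms by (auto simp: Lp_function_2_iff)
qed

lemma Lp_function_2_diff:
  assumes "Lp_function 2 \<mu> f" "Lp_function 2 \<mu> h"
  shows "Lp_function 2 \<mu> (\<lambda>x. f x - h x)"
  using Lp_function_2_add[OF assms(1) Lp_function_2_scale[OF assms(2), of "-1"]] by simp

lemma Lp_function_2_sum:
  assumes "\<And>j. j \<in> J \<Longrightarrow> Lp_function 2 \<mu> (h j)"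
  shows "Lp_function 2 \<mu> (\<lambda>x. \<Sum>j\<in>J. h j x)"
  using assms
proof (induction J rule: infinite_finite_induct)
  case (insert j J)
  then show ?case by (simp add: Lp_function_2_add)
qed (simp_all add: Lp_function_2_iff)

lemma Lp_function_2_restrict:
  assumes "Lp_function 2 \<mu> f" "E \<in> sets \<mu>"
  shows "Lp_function 2 \<mu> (\<lambda>x. indicator E x * f x)"
proof -
  have "(\<lambda>x. (cmod (indicator E x * f x))\<^sup>2) = (\<lambda>x. indicator E x * (cmod (f x))\<^sup>2)"
    by (auto simp: indicator_def)
  with assms show ?thesis
    by (auto simp: Lp_function_2_iff intro!: integrable_real_mult_indicator
        simp: mult.commute[of "indicator E _"])
qed

text \<open>Domination by \<open>|f|^2 + |h|^2\<close> makes \<open>L2_inner\<close> a convergent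
  integral rather than the default value 0, so that it is linear on square-integrable
  functions.\<close>

lemma integrable_mult_cnj:
  assumes "Lp_function 2 \<mu> f" "Lp_function 2 \<mu> h"
  shows "integrable \<mu> (\<lambda>x. f x * cnj (h x))"
proof (rule Bochner_Integration.integrable_bound)
  show "integrable \<mu> (\<lambda>x. (cmod (f x))\<^sup>2 + (cmod (h x))\<^sup>2)"
    using assms by (auto simp: Lp_function_2_iff)
  have "cmod (f x) * cmod (h x) \<le> (cmod (f x))\<^sup>2 + (cmod (h x))\<^sup>2" for x
  proof -
    have "0 \<le> (cmod (f x) - cmod (h x))\<^sup>2" "0 \<le> cmod (f x) * cmod (h x)"
      by simp_all
    then show ?thesis unfolding power2_diff by linarith
  qed
  then show "AE x in \<mu>. norm (f x * cnj (h x)) \<le> norm ((cmod (f x))\<^sup>2 + (cmod (h x))\<^sup>2)"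
    by (simp add: norm_mult)
  have [measurable]: "cnj \<in> borel_measurable borel"
    by (intro borel_measurable_continuous_onI continuous_intros)
  have [measurable]: "f \<in> borel_measurable \<mu>" "h \<in> borel_measurable \<mu>"
    using assms by (simp_all add: Lp_function_2_iff)
  show "(\<lambda>x. f x * cnj (h x)) \<in> borel_measurable \<mu>"
    by measurable
qed

lemma L2_inner_diff_left:
  assumes "Lp_function 2 \<mu> f" "Lp_function 2 \<mu> g" "Lp_function 2 \<mu> h"
  shows "L2_inner \<mu> (\<lambda>x. f x - g x) h = L2_inner \<mu> f h - L2_inner \<mu> g h"
  unfolding L2_inner_def
  by (simp add: left_diff_distrib integrable_mult_cnj assms)

lemma L2_inner_scale_right: "L2_inner \<mu> f (\<lambda>x. a * h x) = cnj a * L2_inner \<mu> f h"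
  by (simp add: L2_inner_def mult.left_commute)

lemma L2_inner_commute: "L2_inner \<mu> h f = cnj (L2_inner \<mu> f h)"
  unfolding L2_inner_def by (subst Bochner_Integration.integral_cnj[symmetric]) (simp add: mult.commute)

lemma L2_inner_sum_right:
  assumes "Lp_function 2 \<mu> f" "\<And>j. j \<in> J \<Longrightarrow> Lp_function 2 \<mu> (h j)"
  shows "L2_inner \<mu> f (\<lambda>x. \<Sum>j\<in>J. a j * h j x) = (\<Sum>j\<in>J. cnj (a j) * L2_inner \<mu> f (h j))"
proof -
  have "L2_inner \<mu> f (\<lambda>x. \<Sum>j\<in>J. a j * h j x)
      = (\<integral>x. (\<Sum>j\<in>J. f x * cnj (a j * h j x)) \<partial>\<mu>)"
    by (simp add: L2_inner_def sum_distrib_left)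
  also have "\<dots> = (\<Sum>j\<in>J. \<integral>x. f x * cnj (a j * h j x) \<partial>\<mu>)"
    by (intro Bochner_Integration.integral_sum integrable_mult_cnj Lp_function_2_scale assms)
  also have "\<dots> = (\<Sum>j\<in>J. cnj (a j) * L2_inner \<mu> f (h j))"
    using L2_inner_scale_right[of \<mu> f] by (simp add: L2_inner_def)
  finally show ?thesis .
qed

text \<open>Common source of the Cauchy-Schwarz inequality and of the expansion along an orthonormal
  system.\<close>

lemma integral_cmod_power2_diff:
  assumes "Lp_function 2 \<mu> f" "Lp_function 2 \<mu> h"
  shows "(\<integral>x. (cmod (f x - h x))\<^sup>2 \<partial>\<mu>)
    = (\<integral>x. (cmod (f x))\<^sup>2 \<partial>\<mu>) - 2 * Re (L2_inner \<mu> f h) + (\<integral>x. (cmod (h x))\<^sup>2 \<partial>\<mu>)"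
proof -
  have int: "integrable \<mu> (\<lambda>x. f x * cnj (h x))"
    by (intro integrable_mult_cnj assms)
  have "(cmod (f x - h x))\<^sup>2 = (cmod (f x))\<^sup>2 - 2 * Re (f x * cnj (h x)) + (cmod (h x))\<^sup>2" for x
    by (simp add: cmod_power2 power2_diff algebra_simps)
  then have "(\<integral>x. (cmod (f x - h x))\<^sup>2 \<partial>\<mu>)
      = (\<integral>x. (cmod (f x))\<^sup>2 - 2 * Re (f x * cnj (h x)) + (cmod (h x))\<^sup>2 \<partial>\<mu>)"
    by (rule Bochner_Integration.integral_cong[OF refl])
  also have "\<dots> = (\<integral>x. (cmod (f x))\<^sup>2 \<partial>\<mu>) - 2 * (\<integral>x. Re (f x * cnj (h x)) \<partial>\<mu>)
      + (\<integral>x. (cmod (h x))\<^sup>2 \<partial>\<mu>)"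
    using assms int integrable_Re[OF int]
    by (simp add: Lp_function_2_iff del: times_complex.sel)
  also have "(\<integral>x. Re (f x * cnj (h x)) \<partial>\<mu>) = Re (L2_inner \<mu> f h)"
    unfolding L2_inner_def by (rule integral_Re[OF int])
  finally show ?thesis .
qed

lemma integral_cmod_power2_eq_inner:
  assumes "Lp_function 2 \<mu> h"
  shows "(\<integral>x. (cmod (h x))\<^sup>2 \<partial>\<mu>) = Re (L2_inner \<mu> h h)"
proof -
  have "h x * cnj (h x) = of_real ((cmod (h x))\<^sup>2)" for x
    by (rule complex_norm_square[symmetric])
  then show ?thesis
    by (simp add: L2_inner_def del: of_real_power)
qed

text \<open>Subtracting from \<open>f\<close> its projection onto \<open>h\<close> leaves a function
  whose squared norm is nonnegative.\<close>

lemma L2_inner_Cauchy_Schwarz: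
  assumes "Lp_function 2 \<mu> f" "Lp_function 2 \<mu> h"
  shows "(cmod (L2_inner \<mu> f h))\<^sup>2
    \<le> (\<integral>x. (cmod (f x))\<^sup>2 \<partial>\<mu>) * (\<integral>x. (cmod (h x))\<^sup>2 \<partial>\<mu>)"
proof (cases "(\<integral>x. (cmod (h x))\<^sup>2 \<partial>\<mu>) = 0")
  case True
  \<comment> \<open>A function of norm zero vanishes almost everywhere; treating this case apart
    permits the division by \<open>N\<close> below.\<close>
  then have "AE x in \<mu>. h x = 0"
    using assms by (subst (asm) integral_nonneg_eq_0_iff_AE) (auto simp: Lp_function_2_iff)
  then have "L2_inner \<mu> f h = 0"
    unfolding L2_inner_def by (intro integral_eq_zero_AE) auto
  with True show ?thesis by simp
next
  case False
  define c where "c = L2_inner \<mu> f h"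
  define N where "N = (\<integral>x. (cmod (h x))\<^sup>2 \<partial>\<mu>)"
  have N: "N > 0"
    using False unfolding N_def by (simp add: less_le)
  \<comment> \<open>This coefficient minimizes the distance from \<open>f\<close> to the multiples
    of \<open>h\<close>.\<close>
  define a where "a = c / of_real N"
  have "0 \<le> (\<integral>x. (cmod (f x - a * h x))\<^sup>2 \<partial>\<mu>)"
    by simp
  also have "\<dots> = (\<integral>x. (cmod (f x))\<^sup>2 \<partial>\<mu>) - 2 * Re (cnj a * c) + (cmod a)\<^sup>2 * N"
    using assms by (simp add: integral_cmod_power2_diff Lp_function_2_scale
        L2_inner_scale_right norm_mult power_mult_distrib c_def N_def)
  also have "Re (cnj a * c) = (cmod c)\<^sup>2 / N"
    unfolding cmod_power2 by (simp add: a_def power2_eq_square add_divide_distrib)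
  also have "(cmod a)\<^sup>2 * N = (cmod c)\<^sup>2 / N"
    using N by (simp add: a_def norm_divide power_divide power2_eq_square)
  finally have "(cmod c)\<^sup>2 / N \<le> (\<integral>x. (cmod (f x))\<^sup>2 \<partial>\<mu>)"
    by simp
  with N show ?thesis by (simp add: divide_le_eq c_def N_def)
qed

section \<open>Orthonormal expansions and concentration\<close>

text \<open>Completing the square in each coefficient. With \<open>a\<close> the Fourier
  coefficients it yields Bessel's inequality; with \<open>a\<close> from the density of finite
  combinations it yields the converse bound.\<close>

lemma integral_cmod_power2_diff_orthonormal:
  assumes e: "L2_orthonormal_basis \<mu> e" and f: "Lp_function 2 \<mu> f" and J: "finite J"
  shows "(\<integral>x. (cmod (f x - (\<Sum>j\<in>J. a j * e j x)))\<^sup>2 \<partial>\<mu>)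
    = (\<integral>x. (cmod (f x))\<^sup>2 \<partial>\<mu>) - (\<Sum>j\<in>J. (cmod (fourier_coeff \<mu> e f j))\<^sup>2)
      + (\<Sum>j\<in>J. (cmod (fourier_coeff \<mu> e f j - a j))\<^sup>2)"
proof -
  define h where "h = (\<lambda>x. \<Sum>j\<in>J. a j * e j x)"
  have eL: "Lp_function 2 \<mu> (e j)" for j
    using e by (simp add: L2_orthonormal_basis_def)
  have hL: "Lp_function 2 \<mu> h"
    unfolding h_def by (intro Lp_function_2_sum Lp_function_2_scale eL)
  have fh: "L2_inner \<mu> f h = (\<Sum>j\<in>J. cnj (a j) * fourier_coeff \<mu> e f j)"
    unfolding h_def fourier_coeff_def by (rule L2_inner_sum_right[OF f eL])
  have he: "L2_inner \<mu> h (e j) = a j" if "j \<in> J" for j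
  proof -
    have "L2_inner \<mu> (e j) h = (\<Sum>i\<in>J. cnj (a i) * L2_inner \<mu> (e j) (e i))"
      unfolding h_def by (rule L2_inner_sum_right[OF eL eL])
    also have "\<dots> = (\<Sum>i\<in>J. if i = j then cnj (a i) else 0)"
      using e by (intro sum.cong) (auto simp: L2_orthonormal_basis_def)
    also have "\<dots> = cnj (a j)"
      using J that by simp
    finally show ?thesis using L2_inner_commute[of \<mu> h "e j"] by simp
  qed
  \<comment> \<open>Only the right factor is expanded; \<open>he\<close> evaluates the remaining
    inner products.\<close>
  have "L2_inner \<mu> h h = (\<Sum>j\<in>J. cnj (a j) * L2_inner \<mu> h (e j))"
    using L2_inner_sum_right[OF hL eL, where J = J and a = a] by (simp add: h_def)
  then have hh: "L2_inner \<mu> h h = (\<Sum>j\<in>J. cnj (a j) * a j)"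
    by (simp add: he)
  have "(\<integral>x. (cmod (f x - h x))\<^sup>2 \<partial>\<mu>) = (\<integral>x. (cmod (f x))\<^sup>2 \<partial>\<mu>)
      + (\<Sum>j\<in>J. - 2 * Re (cnj (a j) * fourier_coeff \<mu> e f j) + Re (cnj (a j) * a j))"
    by (simp add: integral_cmod_power2_diff[OF f hL] integral_cmod_power2_eq_inner[OF hL] fh hh
        sum.distrib sum_distrib_left sum_negf sum_subtractf)
  also have "\<dots> = (\<integral>x. (cmod (f x))\<^sup>2 \<partial>\<mu>)
      + (\<Sum>j\<in>J. (cmod (fourier_coeff \<mu> e f j - a j))\<^sup>2 - (cmod (fourier_coeff \<mu> e f j))\<^sup>2)"
    by (intro arg_cong2[of _ _ _ _ "(+)"] sum.cong refl)
       (unfold cmod_power2, simp add: power2_eq_square algebra_simps)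
  finally show ?thesis by (simp add: h_def sum_subtractf)
qed

lemma Bessel_inequality:
  assumes "L2_orthonormal_basis \<mu> e" "Lp_function 2 \<mu> f" "finite J"
  shows "(\<Sum>j\<in>J. (cmod (fourier_coeff \<mu> e f j))\<^sup>2) \<le> (\<integral>x. (cmod (f x))\<^sup>2 \<partial>\<mu>)"
proof -
  have "0 \<le> (\<integral>x. (cmod (f x - (\<Sum>j\<in>J. fourier_coeff \<mu> e f j * e j x)))\<^sup>2 \<partial>\<mu>)"
    by simp
  then show ?thesis
    by (simp add: integral_cmod_power2_diff_orthonormal[OF assms])
qed

text \<open>The half of Parseval that rests on completeness: a finite combination within
  \<open>\<delta>\<close> of \<open>f\<close> bounds the norm by finitely many coefficients.
  Assumption \<open>c\<close> makes the right-hand side a convergent sum rather than the default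
  value 0.\<close>

lemma integral_le_sum_fourier_coeff:
  assumes e: "L2_orthonormal_basis \<mu> e" and f: "Lp_function 2 \<mu> f"
    and c: "Lp_function 2 (count_space UNIV) (fourier_coeff \<mu> e f)"
  shows "(\<integral>x. (cmod (f x))\<^sup>2 \<partial>\<mu>)
    \<le> (\<integral>j. (cmod (fourier_coeff \<mu> e f j))\<^sup>2 \<partial>count_space UNIV)"
    (is "?n \<le> ?s")
proof (rule field_le_epsilon)
  fix \<delta> :: real assume "\<delta> > 0"
  then obtain N a where Na: "(\<integral>x. (cmod (f x - (\<Sum>j<N. a j * e j x)))\<^sup>2 \<partial>\<mu>) < \<delta>"
    using e f unfolding L2_orthonormal_basis_def by blast
  have int: "integrable (count_space UNIV) (\<lambda>j. (cmod (fourier_coeff \<mu> e f j))\<^sup>2)"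
    using c by (simp add: Lp_function_2_iff)
  then have "(\<Sum>j<N. (cmod (fourier_coeff \<mu> e f j))\<^sup>2) \<le> ?s"
    unfolding integral_count_space_nat[OF int] integrable_count_space_nat_iff
    by (intro sum_le_suminf) auto
  moreover have "0 \<le> (\<Sum>j<N. (cmod (fourier_coeff \<mu> e f j - a j))\<^sup>2)"
    by (simp add: sum_nonneg)
  ultimately show "?n \<le> ?s + \<delta>"
    using Na integral_cmod_power2_diff_orthonormal[OF e f finite_lessThan, where a = a]
    by simp
qed

text \<open>Squaring shows what the level encodes: at most the fraction \<open>r^2\<close> of the
  squared norm lies outside \<open>E\<close>.\<close>

lemma Lp_concentrated_2_bound:
  assumes c: "Lp_concentrated 2 \<mu> f E ((1 - r\<^sup>2) powr (-1/2))" and r: "0 \<le> r" "r < 1"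
  shows "(1 - r\<^sup>2) * (\<integral>x. (cmod (f x))\<^sup>2 \<partial>\<mu>) \<le> (\<integral>x\<in>E. (cmod (f x))\<^sup>2 \<partial>\<mu>)"
proof -
  define A where "A = (\<integral>x. (cmod (f x))\<^sup>2 \<partial>\<mu>)"
  define B where "B = (\<integral>x\<in>E. (cmod (f x))\<^sup>2 \<partial>\<mu>)"
  have AB: "0 \<le> A" "0 \<le> B"
    by (auto simp: A_def B_def set_lebesgue_integral_def)
  have p: "0 < 1 - r\<^sup>2"
    using r by (simp add: power_less_one_iff abs_square_less_1)
  have "sqrt A \<le> (1 - r\<^sup>2) powr (-1/2) * sqrt B"
    using c AB by (simp add: Lp_concentrated_def A_def B_def powr_half_sqrt)
  also have "(1 - r\<^sup>2) powr (-1/2) = inverse (sqrt (1 - r\<^sup>2))"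
    using p powr_minus[of "1 - r\<^sup>2" "1/2"] by (simp add: powr_half_sqrt)
  finally have "sqrt A * sqrt (1 - r\<^sup>2) \<le> sqrt B"
    using p by (simp add: field_simps)
  then have "sqrt (A * (1 - r\<^sup>2)) \<le> sqrt B"
    by (simp add: real_sqrt_mult)
  then show ?thesis by (simp add: A_def B_def mult.commute)
qed

text \<open>The analytic core, on an arbitrary measure space and free of divisions;
  \<open>|E|\<close> and \<open>#X\<close> enter only when the averages are formed.\<close>

lemma concentration_uncertainty:
  assumes e: "L2_orthonormal_basis \<mu> e" and f: "Lp_function 2 \<mu> f"
    and nz: "\<not> (AE x in \<mu>. f x = 0)" and X: "finite X"
    and cE: "Lp_concentrated 2 \<mu> f E ((1 - eps\<^sup>2) powr (-1/2))"
    and cX: "Lp_concentrated 2 (count_space UNIV) (fourier_coeff \<mu> e f) X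
      ((1 - eps'\<^sup>2) powr (-1/2))"
    and eps: "0 \<le> eps" "0 \<le> eps'" "eps + eps' < 1"
  shows "(1 - eps - eps')\<^sup>2 \<le> (\<Sum>j\<in>X. \<integral>x\<in>E. (cmod (e j x))\<^sup>2 \<partial>\<mu>)"
proof -
  define n where "n = (\<integral>x. (cmod (f x))\<^sup>2 \<partial>\<mu>)"
  define fE where "fE = (\<lambda>x. indicator E x * f x)"
  define a where "a = fourier_coeff \<mu> e f"
  define b where "b = fourier_coeff \<mu> e fE"
  define T where "T = (\<Sum>j\<in>X. \<integral>x\<in>E. (cmod (e j x))\<^sup>2 \<partial>\<mu>)"
  have E: "E \<in> sets \<mu>" using cE by (simp add: Lp_concentrated_def)
  have eL: "Lp_function 2 \<mu> (e j)" for j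
    using e by (simp add: L2_orthonormal_basis_def)
  have fEL: "Lp_function 2 \<mu> fE"
    unfolding fE_def by (intro Lp_function_2_restrict f E)
  \<comment> \<open>Positivity of \<open>n\<close> allows it to be cancelled at the end.\<close>
  have "n \<noteq> 0"
    unfolding n_def using nz f
    by (subst integral_nonneg_eq_0_iff_AE) (auto simp: Lp_function_2_iff)
  moreover have "n \<ge> 0" by (simp add: n_def)
  ultimately have n: "n > 0" by simp
  have setint: "(\<integral>x\<in>E. (cmod (h x))\<^sup>2 \<partial>\<mu>) = (\<integral>x. (cmod (indicator E x * h x))\<^sup>2 \<partial>\<mu>)" for h
    unfolding set_lebesgue_integral_def
    by (intro Bochner_Integration.integral_cong) (auto simp: indicator_def)

  \<comment> \<open>Pythagoras: \<open>fE\<close> and \<open>f - fE\<close> are nowhere both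
    nonzero.\<close>
  have "(\<integral>x. (cmod (f x - fE x))\<^sup>2 \<partial>\<mu>) = n - (\<integral>x. (cmod (fE x))\<^sup>2 \<partial>\<mu>)"
  proof -
    have "(cmod (f x - fE x))\<^sup>2 = (cmod (f x))\<^sup>2 - (cmod (fE x))\<^sup>2" for x
      by (simp add: fE_def indicator_def)
    then show ?thesis using f fEL by (simp add: Lp_function_2_iff n_def)
  qed
  moreover have "(1 - eps\<^sup>2) * n \<le> (\<integral>x. (cmod (fE x))\<^sup>2 \<partial>\<mu>)"
    using Lp_concentrated_2_bound[OF cE] eps by (simp add: setint n_def fE_def)
  ultimately have rest: "(\<integral>x. (cmod (f x - fE x))\<^sup>2 \<partial>\<mu>) \<le> eps\<^sup>2 * n"
    by (simp add: algebra_simps)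
  have fE_le: "(\<integral>x. (cmod (fE x))\<^sup>2 \<partial>\<mu>) \<le> n"
    unfolding n_def using f fEL
    by (intro integral_mono) (auto simp: Lp_function_2_iff fE_def indicator_def)

  have "(\<Sum>j\<in>X. (cmod (a j - b j))\<^sup>2) \<le> eps\<^sup>2 * n"
  proof -
    have "a j - b j = fourier_coeff \<mu> e (\<lambda>x. f x - fE x) j" for j
      by (simp add: a_def b_def fourier_coeff_def L2_inner_diff_left f fEL eL)
    then show ?thesis
      using Bessel_inequality[OF e Lp_function_2_diff[OF f fEL] X] rest by simp
  qed
  then have ab: "L2_set (\<lambda>j. cmod (a j - b j)) X \<le> eps * sqrt n"
    using eps real_sqrt_le_mono by (fastforce simp: L2_set_def real_sqrt_mult)

  \<comment> \<open>Since \<open>eps'^2 <= eps'\<close>. This replaces the square root of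
    \<open>1 - eps'^2\<close> by the linear factor \<open>1 - eps'\<close>, which combines with the
    loss \<open>eps\<close> in the triangle inequality.\<close>
  have "(1 - eps')\<^sup>2 * n \<le> (1 - eps'\<^sup>2) * n"
    using eps n by (intro mult_right_mono) (auto simp: power2_eq_square algebra_simps mult_left_le)
  also have "\<dots> \<le> (1 - eps'\<^sup>2) * (\<integral>j. (cmod (a j))\<^sup>2 \<partial>count_space UNIV)"
    using integral_le_sum_fourier_coeff[OF e f] cX eps
    by (intro mult_left_mono) (auto simp: n_def a_def Lp_concentrated_def abs_square_le_1)
  also have "\<dots> \<le> (\<integral>j\<in>X. (cmod (a j))\<^sup>2 \<partial>count_space UNIV)"
    using Lp_concentrated_2_bound[OF cX] eps by (simp add: a_def)
  also have "\<dots> = (\<Sum>j\<in>X. (cmod (a j))\<^sup>2)"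
  proof -
    have "(\<integral>j\<in>X. (cmod (a j))\<^sup>2 \<partial>count_space UNIV)
        = (\<Sum>j | j \<in> UNIV \<and> indicat_real X j *\<^sub>R (cmod (a j))\<^sup>2 \<noteq> 0.
            indicat_real X j *\<^sub>R (cmod (a j))\<^sup>2)"
      unfolding set_lebesgue_integral_def
      by (rule lebesgue_integral_count_space_finite_support)
         (auto intro: finite_subset[OF _ X] simp: indicator_def)
    also have "\<dots> = (\<Sum>j\<in>X. (cmod (a j))\<^sup>2)"
      by (rule sum.mono_neutral_cong_left) (use X in \<open>auto simp: indicator_def\<close>)
    finally show ?thesis .
  qed
  finally have "(1 - eps') * sqrt n \<le> L2_set (\<lambda>j. cmod (a j)) X"
    using eps real_sqrt_le_mono by (fastforce simp: L2_set_def real_sqrt_mult)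
  \<comment> \<open>Minkowski's inequality on \<open>X\<close>, applied to
    \<open>a = b + (a - b)\<close>.\<close>
  also have "\<dots> \<le> L2_set (\<lambda>j. cmod (b j) + cmod (a j - b j)) X"
    by (intro L2_set_mono) (auto intro: norm_triangle_sub)
  also have "\<dots> \<le> L2_set (\<lambda>j. cmod (b j)) X + eps * sqrt n"
    using L2_set_triangle_ineq[of "\<lambda>j. cmod (b j)" "\<lambda>j. cmod (a j - b j)" X] ab by simp
  finally have "(1 - eps - eps') * sqrt n \<le> L2_set (\<lambda>j. cmod (b j)) X"
    by (simp add: algebra_simps)
  \<comment> \<open>Squaring preserves the inequality because \<open>eps + eps' < 1\<close> makes
    the left side nonnegative.\<close>
  then have "((1 - eps - eps') * sqrt n)\<^sup>2 \<le> (L2_set (\<lambda>j. cmod (b j)) X)\<^sup>2"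
    using eps n by (intro power_mono) auto
  then have "(1 - eps - eps')\<^sup>2 * n \<le> (\<Sum>j\<in>X. (cmod (b j))\<^sup>2)"
    using n by (simp add: L2_set_def power_mult_distrib sum_nonneg)
  also have "\<dots> \<le> (\<Sum>j\<in>X. n * (\<integral>x\<in>E. (cmod (e j x))\<^sup>2 \<partial>\<mu>))"
  proof (rule sum_mono)
    fix j
    \<comment> \<open>The indicator is idempotent, so the truncation to \<open>E\<close> may be
      copied onto \<open>e j\<close>; Cauchy-Schwarz then sees \<open>e j\<close> on
      \<open>E\<close> alone.\<close>
    have "b j = L2_inner \<mu> fE (\<lambda>x. indicator E x * e j x)"
      unfolding b_def fourier_coeff_def L2_inner_def fE_def
      by (intro Bochner_Integration.integral_cong) (auto simp: indicator_def)
    then have "(cmod (b j))\<^sup>2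
        \<le> (\<integral>x. (cmod (fE x))\<^sup>2 \<partial>\<mu>) * (\<integral>x\<in>E. (cmod (e j x))\<^sup>2 \<partial>\<mu>)"
      using L2_inner_Cauchy_Schwarz[OF fEL Lp_function_2_restrict[OF eL E]] by (simp add: setint)
    also have "\<dots> \<le> n * (\<integral>x\<in>E. (cmod (e j x))\<^sup>2 \<partial>\<mu>)"
      by (intro mult_right_mono fE_le) (simp add: setint)
    finally show "(cmod (b j))\<^sup>2 \<le> n * (\<integral>x\<in>E. (cmod (e j x))\<^sup>2 \<partial>\<mu>)" .
  qed
  finally have "(1 - eps - eps')\<^sup>2 * n \<le> T * n"
    by (simp add: T_def sum_distrib_left mult.commute)
  with n show ?thesis by (simp add: T_def)
qed

section \<open>Finiteness of the volume\<close>

text \<open>The determinant is a polynomial in the entries; the hypothesis is entrywise because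
  smoothness of the metric is.\<close>

lemma continuous_on_det:
  fixes A :: "'b::topological_space \<Rightarrow> real^'n^'n"
  assumes "\<And>i j. continuous_on S (\<lambda>x. A x $ i $ j)"
  shows "continuous_on S (\<lambda>x. det (A x))"
  unfolding det_def by (intro continuous_intros assms)

text \<open>The volume density is continuous, hence bounded, on a compact coordinate ball, so the
  part of the manifold over the open ball has volume at most that bound times a Lebesgue
  volume.\<close>

lemma riemannian_borel_volume_locally_finite:
  assumes M: "smooth_manifold M" "riemannian_metric M"
    and \<nu>: "riemannian_borel_volume M \<nu>"
    and p: "p \<in> topspace (top_of M)"
  obtains U where "openin (top_of M) U" "p \<in> U" "emeasure \<nu> U < \<infinity>"
proof -
  obtain c where c: "c \<in> atlas M" "p \<in> fst c"
    using M(1) p unfolding smooth_manifold_def by blast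
  have cU: "openin (top_of M) (fst c)" and co: "open (chart_image c)"
    and hom: "homeomorphic_map (subtopology (top_of M) (fst c)) (top_of_set (chart_image c)) (snd c)"
    using M(1) c by (auto simp: smooth_manifold_def)
  obtain r where r: "r > 0" "cball (snd c p) r \<subseteq> chart_image c"
    using co c open_contains_cball unfolding chart_image_def by blast
  let ?B = "ball (snd c p) r" and ?C = "cball (snd c p) r"
  define U where "U = {q \<in> fst c. snd c q \<in> ?B}"
  have BC: "?B \<subseteq> ?C" by auto
  have "openin (top_of_set (chart_image c)) ?B"
    using r BC by (intro open_subset) auto
  then have "openin (subtopology (top_of M) (fst c))
      {q \<in> topspace (subtopology (top_of M) (fst c)). snd c q \<in> ?B}"
    using hom by (intro openin_continuous_map_preimage) (auto dest: homeomorphic_imp_continuous_map)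
  \<comment> \<open>Thus \<open>U\<close> is open in the chart domain, and therefore in the
    manifold, as that domain is open.\<close>
  moreover have "topspace (subtopology (top_of M) (fst c)) = fst c"
    using openin_subset[OF cU] by auto
  ultimately have "openin (subtopology (top_of M) (fst c)) U"
    unfolding U_def by (simp only:)
  then have U: "openin (top_of M) U"
    using cU by (rule openin_trans_full)
  have "continuous_on (chart_image c) (\<lambda>x. metric M c x $ i $ j)" for i j
  proof -
    have "Ck_on 0 (chart_image c) (\<lambda>x. metric M c x $ i $ j)"
      using M(2) c unfolding riemannian_metric_def smooth_on_def by blast
    then show ?thesis by simp
  qed
  then have "continuous_on ?C (\<lambda>x. sqrt (det (metric M c x)))"
    by (intro continuous_on_real_sqrt continuous_on_det continuous_on_subset[OF _ r(2)])
  then have "bounded ((\<lambda>x. sqrt (det (metric M c x))) ` ?C)"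
    by (intro compact_imp_bounded compact_continuous_image) auto
  then obtain K where K: "\<And>x. x \<in> ?C \<Longrightarrow> sqrt (det (metric M c x)) \<le> K"
    unfolding bounded_real by (force simp: abs_le_iff)
  have "U \<in> sets \<nu>"
    using \<nu> U by (auto simp: riemannian_borel_volume_def)
  then have "emeasure \<nu> U = (\<integral>\<^sup>+ x\<in>snd c ` U. ennreal (sqrt (det (metric M c x))) \<partial>lborel)"
    using \<nu> c by (auto simp: riemannian_borel_volume_def U_def)
  \<comment> \<open>The coordinate image of \<open>U\<close> lies in \<open>?B\<close>, hence in
    \<open>?C\<close>, where \<open>K\<close> bounds the density.\<close>
  also have "\<dots> \<le> (\<integral>\<^sup>+ x. ennreal K * indicator ?C x \<partial>lborel)"
    using K by (intro nn_integral_mono) (auto simp: U_def indicator_def intro!: ennreal_leI)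
  also have "\<dots> = ennreal K * emeasure lborel ?C"
    by (subst nn_integral_cmult_indicator) auto
  also have "\<dots> < \<infinity>"
    using emeasure_lborel_cball_finite[of "snd c p" r] by (simp add: ennreal_mult_less_top)
  finally show ?thesis
    using that U c r by (auto simp: U_def)
qed

text \<open>Finitely many open sets of finite volume cover the compact manifold, and completion
  preserves the total mass.\<close>

lemma finite_measure_riemannian_volume:
  assumes M: "compact_riemannian_manifold M" and vol: "riemannian_volume M vol"
  shows "finite_measure vol"
proof -
  obtain \<nu> where \<nu>: "riemannian_borel_volume M \<nu>" and vol: "vol = completion \<nu>"
    using vol by (auto simp: riemannian_volume_def)
  have space: "space \<nu> = topspace (top_of M)"
    using \<nu> by (simp add: riemannian_borel_volume_def)
  let ?\<U> = "{U. openin (top_of M) U \<and> emeasure \<nu> U < \<infinity>}"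
  have "smooth_manifold M" "riemannian_metric M" and compact: "compact_space (top_of M)"
    using M by (simp_all add: compact_riemannian_manifold_def)
  have cover: "topspace (top_of M) \<subseteq> \<Union>?\<U>"
  proof
    fix p assume "p \<in> topspace (top_of M)"
    then obtain U where "openin (top_of M) U" "p \<in> U" "emeasure \<nu> U < \<infinity>"
      using riemannian_borel_volume_locally_finite
        [OF \<open>smooth_manifold M\<close> \<open>riemannian_metric M\<close> \<nu>] by blast
    then show "p \<in> \<Union>?\<U>" by blast
  qed
  have "\<exists>\<F>. finite \<F> \<and> \<F> \<subseteq> ?\<U> \<and> topspace (top_of M) \<subseteq> \<Union>\<F>"
    using compact cover unfolding compact_space_alt
    by (elim allE[of _ ?\<U>] mp) auto
  then obtain \<F> where \<F>: "finite \<F>" "\<F> \<subseteq> ?\<U>" "topspace (top_of M) \<subseteq> \<Union>\<F>"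
    by (elim exE conjE)
  have meas: "\<F> \<subseteq> sets \<nu>"
    using \<F>(2) \<nu> by (auto simp: riemannian_borel_volume_def)
  have "emeasure \<nu> (space \<nu>) \<le> emeasure \<nu> (\<Union>U\<in>\<F>. U)"
    using \<F> meas by (intro emeasure_mono) (auto simp: space intro!: sets.finite_UN)
  also have "\<dots> \<le> (\<Sum>U\<in>\<F>. emeasure \<nu> U)"
    using \<F>(1) meas by (intro emeasure_subadditive_finite) auto
  also have "\<dots> < \<infinity>"
    using \<F>(1,2) by (auto simp: less_top)
  finally have "emeasure vol (space vol) \<noteq> \<infinity>"
    by (simp add: vol)
  then show ?thesis by (rule finite_measureI)
qed

section \<open>Finiteness of the frequency set and the final estimate\<close>

lemma finite_vimage_filterlim_at_top:
  fixes lam :: "nat \<Rightarrow> real"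
  assumes "filterlim lam at_top sequentially" "finite S"
  shows "finite {j. lam j \<in> S}"
proof -
  have "eventually (\<lambda>j. lam j > s) sequentially" for s
    using assms(1) by (simp add: filterlim_at_top_dense)
  \<comment> \<open>Finiteness of \<open>S\<close> lets one threshold serve all its elements, so
    only finitely many indices can hit \<open>S\<close>.\<close>
  then have "eventually (\<lambda>j. \<forall>s\<in>S. lam j > s) sequentially"
    using assms(2) by (simp add: eventually_ball_finite)
  then have "eventually (\<lambda>j. lam j \<notin> S) cofinite"
    unfolding cofinite_eq_sequentially by eventually_elim auto
  then show ?thesis by (simp add: eventually_cofinite)
qed

text \<open>The reciprocal is taken in \<open>ereal\<close>, where 0 has inverse infinity; the
  conclusion thus includes that the average is nonzero. Indices start at 0, so \<open>lam 0\<close>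
  is the first eigenvalue.\<close>

theorem proposition1p7:
  fixes M :: "('a, 'n::finite) riem"
    and vol :: "'a measure"
    and e :: "nat \<Rightarrow> 'a \<Rightarrow> complex"
    and lam :: "nat \<Rightarrow> real"
    and S :: "real set" and X :: "nat set"
    and f :: "'a \<Rightarrow> complex" and E :: "'a set"
    and L L' eps eps' :: real
  assumes "compact_riemannian_manifold M"
    and "riemannian_volume M vol"
    and "L2_orthonormal_basis vol e"
    and "\<And>j. lam j \<ge> 0"
    and "\<And>j. laplace_eigenfunction M (lam j) (e j)"
    and "lam 0 = 0" and "mono lam" and "filterlim lam at_top sequentially"
    and "finite S" and "S \<subseteq> sqrt_laplacian_eigenvalues M"
    and "X = {j. lam j \<in> S}"
    and "Lp_function 2 vol f" and "\<not> (AE x in vol. f x = 0)"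
    and "Lp_concentrated 2 vol f E L"
    and "Lp_concentrated 2 (count_space UNIV) (fourier_coeff vol e f) X L'"
    and "0 \<le> eps" and "eps < 1" and "0 \<le> eps'" and "eps' < 1"
    and "eps + eps' < 1"
    and "L = (1 - eps\<^sup>2) powr (-1/2)"
    and "L' = (1 - eps'\<^sup>2) powr (-1/2)"
  shows "inverse (ereal (1 / real (card X) *
             (\<Sum>j\<in>X. 1 / measure vol E * (\<integral>x\<in>E. (cmod (e j x))\<^sup>2 \<partial>vol))))
         \<le> ereal ((1 - eps - eps') powi (-2) * measure vol E * real (card X))"
proof -
  \<comment> \<open>Finiteness ensures that \<open>measure vol E\<close> is the true volume, not the
    default value 0 for infinite measure.\<close>
  interpret finite_measure vol
    using assms(1,2) by (rule finite_measure_riemannian_volume)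
  define T where "T = (\<Sum>j\<in>X. \<integral>x\<in>E. (cmod (e j x))\<^sup>2 \<partial>vol)"
  define m where "m = measure vol E"
  have X: "finite X"
    using finite_vimage_filterlim_at_top assms by simp
  have E: "E \<in> sets vol"
    using assms by (simp add: Lp_concentrated_def)
  have T: "(1 - eps - eps')\<^sup>2 \<le> T"
    unfolding T_def using assms X by (intro concentration_uncertainty[where f = f]) simp_all
  moreover have d: "0 < (1 - eps - eps')\<^sup>2"
    using assms by simp
  ultimately have T0: "0 < T" by linarith
  then have card: "card X > 0"
    using X by (auto simp: T_def card_gt_0_iff)
  \<comment> \<open>On a null set all integrals in \<open>T\<close> would vanish, contradicting
    \<open>T0\<close>.\<close>
  have "m \<noteq> 0"
  proof
    assume "m = 0"
    then have "E \<in> null_sets vol"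
      using E by (auto simp: m_def emeasure_eq_measure)
    then have "(\<integral>x\<in>E. (cmod (e j x))\<^sup>2 \<partial>vol) = 0" for j
      unfolding set_lebesgue_integral_def
      by (intro integral_eq_zero_AE) (auto dest: AE_not_in)
    with T0 show False by (simp add: T_def)
  qed
  then have m: "m > 0"
    by (simp add: m_def zero_less_measure_iff)
  have "1 / real (card X) * (\<Sum>j\<in>X. 1 / m * (\<integral>x\<in>E. (cmod (e j x))\<^sup>2 \<partial>vol))
      = T / (m * real (card X))" (is "?lhs = _")
    by (simp add: T_def flip: sum_divide_distrib)
  \<comment> \<open>The average is nonzero, so the extended reciprocal is the real one and
    \<open>T\<close> can be replaced by its lower bound.\<close>
  then have "inverse (ereal ?lhs) = ereal (m * real (card X) / T)"
    using T0 m card by simp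
  also have "m * real (card X) / T \<le> m * real (card X) / (1 - eps - eps')\<^sup>2"
    using T d T0 m by (intro divide_left_mono) auto
  also have "\<dots> = (1 - eps - eps') powi (-2) * m * real (card X)"
    by (simp add: power_int_minus divide_inverse)
  finally show ?thesis
    by (simp add: m_def)
qed

end
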